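(* Let $G=(V,E)$ be a connected network graph on $n\ge 2$ treatments with positive edge weights, let $A\neq B$ be two treatments, and let $c=A{:}B$. Let $\mathbf{h}_c^\top$ be the row of the hat matrix belonging to $c$, and let $\mathbf{Z}_c$ be the $P\times m$ path-design matrix of $c$. Let $\phi^{\mathrm{sp}}\in\mathbb{R}^P$ be a vector of path weights produced by the shortestpath algorithm and let $\phi^{\mathrm{rw}}\in\mathbb{R}^P$ be the vector of path weights of the randomwalk approach (both defined in the context). Then both $\phi^{\mathrm{sp}}$ and $\phi^{\mathrm{rw}}$ are solutions $\phi\in\mathbb{R}^P$ of the linear system $\mathbf{h}_c^\top=\phi^\top\mathbf{Z}_c$, and both minimize the L1 norm $\sum_{p=1}^P|\phi_p|$ among all solutions $\phi\in\mathbb{R}^P$ of this system; the minimal value is $1$.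
   Context: Setting. $V$ is a set of $n$ treatments, totally ordered, and $m=n(n-1)/2$ is the number of unordered pairs of distinct treatments ("comparisons"). Each comparison $i{:}j$ with $i<j$ has the reference direction $i\to j$. The matrix $\mathbf{B}$ is the $m\times n$ edge-vertex incidence matrix of the complete graph on $V$: the row of $i{:}j$ ($i<j$) has $+1$ in column $i$, $-1$ in column $j$, and $0$ elsewhere. The matrix $\mathbf{W}$ is an $m\times m$ diagonal matrix of inverse variance weights whose diagonal entry is positive for comparisons that are edges of the network graph $G=(V,E)$ and $0$ for all other comparisons. $G$ is connected. The (full) hat matrix is the $m\times m$ matrix $\mathbf{H}=\mathbf{B}(\mathbf{B}^\top\mathbf{W}\mathbf{B})^+\mathbf{B}^\top\mathbf{W}$, where $^+$ denotes the Moore-Penrose pseudoinverse. For a comparison $c=A{:}B$, $\mathbf{h}_c^\top$ denotes row $c$ of $\mathbf{H}$ (if $B<A$ in the order, the negative of the row of $B{:}A$), with entries $h_{ce}$. Directed network for $c=A{:}B$. Each edge $e$ with $h_{ce}>0$ is directed along its reference direction, each edge with $h_{ce}<0$ is directed opposite to its reference direction, and edges with $h_{ce}=0$ are omitted. Edge $e$ carries the flow $|h_{ce}|$. Let $p=1,\dots,P$ enumerate all directed paths from $A$ to $B$ in this directed network. Path-design matrix. $\mathbf{Z}_c$ is the $P\times m$ matrix whose entry in row $p$ and column $e$ is $1$ if path $p$ traverses $e$ along its reference direction, $-1$ if path $p$ traverses $e$ opposite to its reference direction, and $0$ otherwise. shortestpath. Start with the flows $|h_{ce}|$ on the directed network for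 $c$, and with $\phi=0$. Repeatedly choose a directed path $p$ from $A$ to $B$ with the smallest number of edges among those all of whose edges have positive remaining flow (ties broken arbitrarily). Set $\phi_p$ to the minimum remaining flow along the edges of $p$, subtract this amount from the remaining flow of every edge of $p$, and remove edges whose remaining flow is $0$. Stop when no directed path from $A$ to $B$ remains. The result is $\phi^{\mathrm{sp}}$; paths never selected have weight $0$. randomwalk. Consider the random walk on the directed network for $c$ started at $A$ and stopped at $B$, which moves from a node $i\ne B$ along an outgoing directed edge $e$ with probability $|h_{ce}|$ divided by the sum of the flows of all directed edges leaving $i$. Then $\phi^{\mathrm{rw}}_p$ is the probability that the walk follows path $p$, i.e. the product of the transition probabilities along $p$. *)

theory Defs
  imports
    "HOL-Analysis.Analysis"
    "HOL-Library.Cardinality"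
    "Graph_Theory.Digraph_Component"
begin

section \<open>Comparisons and the hat matrix\<close>

text \<open>
  The set of treatments is a finite linearly ordered type; the library class \<^class>\<open>card2\<close>
  says that it is finite with at least two elements, which is what makes the following type
  nonempty. A comparison is an unordered pair of distinct treatments, represented by the
  pair in reference direction (smaller treatment first).
\<close>

typedef (overloaded) 'v comparison = "{(i, j). i < (j :: 'v :: {card2, linorder})}"
  morphisms endpoints Comparison
proof -
  have "\<not> CARD('v) \<le> Suc 0"
    using two_le_card[where 'a = 'v] by simp
  then obtain i j :: 'v where "i \<noteq> j"
    by (auto simp: card_le_Suc0_iff_eq)
  then have "i < j \<or> j < i"
    by auto
  then show ?thesis
    by blast
qed

instance comparison :: ("{card2, linorder}") finite
proof
  have "finite (range (endpoints :: 'a comparison \<Rightarrow> _))"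
    by simp
  then show "finite (UNIV :: 'a comparison set)"
    by (rule finite_imageD) (simp add: inj_def endpoints_inject)
qed

definition ref_tail :: "'v::{card2, linorder} comparison \<Rightarrow> 'v" where
  "ref_tail e = fst (endpoints e)"

definition ref_head :: "'v::{card2, linorder} comparison \<Rightarrow> 'v" where
  "ref_head e = snd (endpoints e)"

lemma card_comparison:
  "CARD('v::{card2, linorder} comparison) = CARD('v) * (CARD('v) - 1) div 2"
proof -
  let ?L = "{(i, j). i < (j :: 'v)}" and ?G = "{(i, j). j < (i :: 'v)}"
  have "CARD('v comparison) = card ?L"
    by (rule type_definition.card[OF type_definition_comparison])
  moreover have "card ?G = card ?L"
    by (rule bij_betw_same_card[of prod.swap]) (auto simp: bij_betw_def inj_on_def image_iff)
  moreover have "card (?L \<union> ?G) = card ?L + card ?G"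
    by (rule card_Un_disjoint) (auto intro: finite_subset[OF subset_UNIV])
  moreover have "?L \<union> ?G = UNIV - range (\<lambda>i. (i, i))"
    by (auto simp: neq_iff)
  moreover have "card (UNIV - range (\<lambda>i :: 'v. (i, i))) = CARD('v) * CARD('v) - CARD('v)"
    by (subst card_Diff_subset) (auto simp: card_image inj_on_def simp flip: UNIV_Times_UNIV)
  ultimately show ?thesis
    by (simp add: diff_mult_distrib2)
qed

definition incidence_matrix :: "real ^ 'v::{card2, linorder} ^ 'v comparison" where
  "incidence_matrix =
     (\<chi> e v. if v = ref_tail e then 1 else if v = ref_head e then - 1 else 0)"

definition is_weight_matrix ::
    "'v::{card2, linorder} comparison set \<Rightarrow> real ^ 'v comparison ^ 'v comparison \<Rightarrow> bool" where
  "is_weight_matrix E W \<longleftrightarrow>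
     (\<forall>e f. e \<noteq> f \<longrightarrow> W $ e $ f = 0) \<and>
     (\<forall>e\<in>E. W $ e $ e > 0) \<and>
     (\<forall>e. e \<notin> E \<longrightarrow> W $ e $ e = 0)"

definition is_pseudoinverse :: "real ^ 'n ^ 'm \<Rightarrow> real ^ 'm ^ 'n \<Rightarrow> bool" where
  "is_pseudoinverse M X \<longleftrightarrow>
     M ** X ** M = M \<and>
     X ** M ** X = X \<and>
     transpose (M ** X) = M ** X \<and>
     transpose (X ** M) = X ** M"

text \<open>The Penrose equations of a real matrix have exactly one solution.\<close>

definition pseudoinverse :: "real ^ 'n ^ 'm \<Rightarrow> real ^ 'm ^ 'n" where
  "pseudoinverse M = (THE X. is_pseudoinverse M X)"

definition hat_matrix ::
    "real ^ 'v::{card2, linorder} comparison ^ 'v comparison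
     \<Rightarrow> real ^ 'v comparison ^ 'v comparison" where
  "hat_matrix W =
     incidence_matrix
     ** pseudoinverse (transpose incidence_matrix ** W ** incidence_matrix)
     ** transpose incidence_matrix ** W"

definition hat_row ::
    "real ^ 'v::{card2, linorder} comparison ^ 'v comparison
     \<Rightarrow> 'v \<Rightarrow> 'v \<Rightarrow> real ^ 'v comparison" where
  "hat_row W A B =
     (if A < B then row (Comparison (A, B)) (hat_matrix W)
      else - row (Comparison (B, A)) (hat_matrix W))"


section \<open>Networks and directed paths\<close>

text \<open>
  The arcs of both digraphs below are the comparisons themselves. The library predicate
  \<^const>\<open>Digraph_Component.connected\<close> ignores arc directions, so applied to
  \<open>network_graph E\<close> it is connectedness of the undirected graph with edge set \<open>E\<close>.
\<close>

definition network_graph ::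
    "'v::{card2, linorder} comparison set \<Rightarrow> ('v, 'v comparison) pre_digraph" where
  "network_graph E = \<lparr> verts = UNIV, arcs = E, tail = ref_tail, head = ref_head \<rparr>"

definition directed_network ::
    "'v::{card2, linorder} comparison set \<Rightarrow> real ^ 'v comparison
     \<Rightarrow> ('v, 'v comparison) pre_digraph" where
  "directed_network E h =
     \<lparr> verts = UNIV,
       arcs = {e \<in> E. h $ e \<noteq> 0},
       tail = (\<lambda>e. if h $ e > 0 then ref_tail e else ref_head e),
       head = (\<lambda>e. if h $ e > 0 then ref_head e else ref_tail e) \<rparr>"

text \<open>
  A directed path is the list of its arcs and does not repeat vertices. Vectors indexed by
  the paths are functions on arc lists, of which only the values on \<open>directed_paths\<close> matter.
\<close>

definition directed_paths :: "('a, 'b) pre_digraph \<Rightarrow> 'a \<Rightarrow> 'a \<Rightarrow> 'b awalk set" where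
  "directed_paths N A B = {p. pre_digraph.apath N A p B}"

definition path_design_matrix ::
    "('v::{card2, linorder}, 'v comparison) pre_digraph
     \<Rightarrow> 'v comparison awalk \<Rightarrow> 'v comparison \<Rightarrow> real" where
  "path_design_matrix N p e =
     (if e \<in> set p \<and> tail N e = ref_tail e \<and> head N e = ref_head e then 1
      else if e \<in> set p \<and> tail N e = ref_head e \<and> head N e = ref_tail e then - 1
      else 0)"

definition solves_path_system ::
    "('v::{card2, linorder}, 'v comparison) pre_digraph \<Rightarrow> real ^ 'v comparison \<Rightarrow> 'v \<Rightarrow> 'v
     \<Rightarrow> ('v comparison awalk \<Rightarrow> real) \<Rightarrow> bool" where
  "solves_path_system N h A B \<phi> \<longleftrightarrow>
     h = (\<chi> e. \<Sum>p\<in>directed_paths N A B. \<phi> p * path_design_matrix N p e)"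

definition path_L1_norm ::
    "('a, 'b) pre_digraph \<Rightarrow> 'a \<Rightarrow> 'a \<Rightarrow> ('b awalk \<Rightarrow> real) \<Rightarrow> real" where
  "path_L1_norm N A B \<phi> = (\<Sum>p\<in>directed_paths N A B. \<bar>\<phi> p\<bar>)"


section \<open>The shortestpath algorithm\<close>

text \<open>
  A state consists of the remaining flow \<open>r\<close> and the weights \<open>\<phi>\<close> found so far. Removing
  exhausted edges is expressed by admitting only paths with positive remaining flow.
\<close>

definition available_paths ::
    "('a, 'b) pre_digraph \<Rightarrow> 'a \<Rightarrow> 'a \<Rightarrow> ('b \<Rightarrow> real) \<Rightarrow> 'b awalk set" where
  "available_paths N A B r = {p \<in> directed_paths N A B. \<forall>e\<in>set p. r e > 0}"

inductive shortestpath_step ::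
    "('a, 'b) pre_digraph \<Rightarrow> 'a \<Rightarrow> 'a
     \<Rightarrow> ('b \<Rightarrow> real) \<times> ('b awalk \<Rightarrow> real) \<Rightarrow> ('b \<Rightarrow> real) \<times> ('b awalk \<Rightarrow> real) \<Rightarrow> bool"
  for N A B where
  "is_arg_min length (\<lambda>q. q \<in> available_paths N A B r) p \<Longrightarrow>
   f = Min (r ` set p) \<Longrightarrow>
   shortestpath_step N A B
     (r, \<phi>) (\<lambda>e. if e \<in> set p then r e - f else r e, \<phi>(p := f))"

text \<open>
  Ties are broken arbitrarily, so the output is a relation: \<open>shortestpath_weights N h A B \<phi>\<close>
  says that some run of the algorithm ends with the weights \<open>\<phi>\<close>.
\<close>

definition shortestpath_weights ::
    "('a, 'b::finite) pre_digraph \<Rightarrow> real ^ 'b \<Rightarrow> 'a \<Rightarrow> 'a \<Rightarrow> ('b awalk \<Rightarrow> real) \<Rightarrow> bool" where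
  "shortestpath_weights N h A B \<phi> \<longleftrightarrow>
     (\<exists>r. (shortestpath_step N A B)\<^sup>*\<^sup>* (\<lambda>e. \<bar>h $ e\<bar>, \<lambda>p. 0) (r, \<phi>) \<and>
          available_paths N A B r = {})"

lemma shortestpath_terminates:
  fixes N :: "('a, 'b::finite) pre_digraph"
  assumes "A \<noteq> B"
  shows "\<exists>r' \<phi>'. (shortestpath_step N A B)\<^sup>*\<^sup>* (r, \<phi>) (r', \<phi>') \<and> available_paths N A B r' = {}"
proof (induction "card {e. r e > 0}" arbitrary: r \<phi> rule: less_induct)
  case less
  show ?case
  proof (cases "available_paths N A B r = {}")
    case True
    then show ?thesis by blast
  next
    case False
    then obtain q where "q \<in> available_paths N A B r"
      by blast
    from ex_has_least_nat[of "\<lambda>q. q \<in> available_paths N A B r", OF this, of length]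
    obtain p where p: "is_arg_min length (\<lambda>q. q \<in> available_paths N A B r) p"
      by (auto simp: is_arg_min_linorder)
    define f where "f = Min (r ` set p)"
    define r' where "r' = (\<lambda>e. if e \<in> set p then r e - f else r e)"
    have avail: "p \<in> available_paths N A B r"
      using p by (simp add: is_arg_min_def)
    then have pos: "\<forall>e\<in>set p. r e > 0"
      by (simp add: available_paths_def)
    have "p \<noteq> []"
      using avail assms
      by (auto simp: available_paths_def directed_paths_def pre_digraph.apath_def
          pre_digraph.awalk_def pre_digraph.cas.simps)
    then have "f \<in> r ` set p"
      unfolding f_def by (intro Min_in) auto
    then obtain e where e: "e \<in> set p" "r e = f"
      by auto
    have "f > 0"
      using e pos by auto
    then have "{x. r' x > 0} \<subset> {x. r x > 0}"
      using e by (auto simp: r'_def split: if_splits)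
    then have "card {x. r' x > 0} < card {x. r x > 0}"
      by (intro psubset_card_mono) auto
    from less[OF this] obtain r'' \<phi>'' where
      "(shortestpath_step N A B)\<^sup>*\<^sup>* (r', \<phi>(p := f)) (r'', \<phi>'')" "available_paths N A B r'' = {}"
      by blast
    moreover have "shortestpath_step N A B (r, \<phi>) (r', \<phi>(p := f))"
      unfolding r'_def by (rule shortestpath_step.intros[OF p f_def])
    ultimately show ?thesis
      by (meson converse_rtranclp_into_rtranclp)
  qed
qed

section \<open>The randomwalk weights\<close>

definition transition_probability :: "('a, 'b::finite) pre_digraph \<Rightarrow> real ^ 'b \<Rightarrow> 'b \<Rightarrow> real" where
  "transition_probability N h e = \<bar>h $ e\<bar> / (\<Sum>f\<in>out_arcs N (tail N e). \<bar>h $ f\<bar>)"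

definition randomwalk_weights :: "('a, 'b::finite) pre_digraph \<Rightarrow> real ^ 'b \<Rightarrow> 'b awalk \<Rightarrow> real" where
  "randomwalk_weights N h p = prod_list (map (transition_probability N h) p)"

end

theory Submission
  imports Defs
begin

text \<open>
  The row of the hat matrix is an electrical flow: with the potential
  \<open>x = (e\<^sub>A - e\<^sub>B)\<^sup>T L\<^sup>+\<close>, where \<open>L\<close> is the weighted Laplacian, the entry at an edge is its weight times
  the drop of \<open>x\<close>. So the directed network is acyclic, and it carries a unit flow from \<open>A\<close> to \<open>B\<close>.
  In any solution each path contributes its weight times the drop \<open>x A - x B\<close> to the total
  dissipation \<open>x A - x B\<close>, so the weights sum to 1. Hence every solution has L1 norm at least 1,
  and every nonnegative solution attains 1.
\<close>

section \<open>The pseudoinverse of a Laplacian\<close>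

lemma matrix_add_rdistrib: "(A + B) ** C = A ** C + B ** C" for C :: "real ^ 'k ^ 'n"
  by (simp add: matrix_matrix_mult_def vec_eq_iff distrib_right sum.distrib)

lemma matrix_diff_ldistrib: "A ** (B - C) = A ** B - A ** C" for C :: "real ^ 'k ^ 'n"
  by (simp add: matrix_matrix_mult_def vec_eq_iff right_diff_distrib sum_subtractf)

lemma matrix_diff_rdistrib: "(A - B) ** C = A ** C - B ** C" for C :: "real ^ 'k ^ 'n"
  by (simp add: matrix_matrix_mult_def vec_eq_iff left_diff_distrib sum_subtractf)

lemma row_matrix_mult: "row i (A ** B) = row i A v* B" for B :: "real ^ 'k ^ 'n"
  by (simp add: row_def matrix_matrix_mult_def vector_matrix_mult_def mult.commute)

lemma uminus_vector_matrix_mult: "(- v) v* A = - (v v* A)" for A :: "real ^ 'k ^ 'n"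
  by (simp add: vector_matrix_mult_def vec_eq_iff sum_negf)

text \<open>\<open>M ** X\<close> and \<open>M ** Y\<close> are both the orthogonal projection onto
  the column space of \<open>M\<close>, hence equal; likewise \<open>X ** M = Y ** M\<close>. Then
  \<open>X = X ** M ** X = Y ** M ** Y = Y\<close>.\<close>

lemma pseudoinverse_unique:
  assumes "is_pseudoinverse M X" and "is_pseudoinverse M Y"
  shows "X = Y"
proof -
  have mp: "M ** X ** M = M" "X ** M ** X = X" "transpose (M ** X) = M ** X" "transpose (X ** M) = X ** M"
    "M ** Y ** M = M" "Y ** M ** Y = Y" "transpose (M ** Y) = M ** Y" "transpose (Y ** M) = Y ** M"
    using assms by (simp_all add: is_pseudoinverse_def)
  have "M ** Y = transpose ((M ** X) ** (M ** Y))"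
    by (metis mp(1,7) matrix_mul_assoc)
  also have "\<dots> = M ** X"
    by (metis mp(3,5,7) matrix_mul_assoc matrix_transpose_mul)
  finally have MXY: "M ** Y = M ** X" .
  have "Y ** M = transpose ((Y ** M) ** (X ** M))"
    by (metis mp(1,8) matrix_mul_assoc)
  also have "\<dots> = X ** M"
    by (metis mp(4,5,8) matrix_mul_assoc matrix_transpose_mul)
  finally have "Y ** M = X ** M" .
  then show ?thesis
    by (metis MXY mp(2,6) matrix_mul_assoc)
qed

lemma pseudoinverse_eqI: "is_pseudoinverse M X \<Longrightarrow> pseudoinverse M = X"
  unfolding pseudoinverse_def by (blast intro: the_equality pseudoinverse_unique)

text \<open>The orthogonal projection onto the constant vectors.\<close>

definition mean_matrix :: "real ^ 'n ^ 'n" where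
  "mean_matrix = (\<chi> i j. 1 / CARD('n))"

lemma mean_matrix_mult_vec: "(mean_matrix *v x) $ i = (\<Sum>j\<in>UNIV. x $ j) / CARD('n)"
  for x :: "real ^ 'n"
  by (simp add: mean_matrix_def matrix_vector_mult_def sum_divide_distrib)

lemma transpose_mean_matrix: "transpose mean_matrix = mean_matrix"
  by (simp add: mean_matrix_def transpose_def)

lemma mean_matrix_idem: "mean_matrix ** mean_matrix = (mean_matrix :: real ^ 'n ^ 'n)"
  by (simp add: mean_matrix_def matrix_matrix_mult_def)

text \<open>
  \<open>L\<close> plus the projection \<open>P\<close> onto the constants is invertible, and the pseudoinverse of \<open>L\<close>
  is \<open>(L + P)\<^sup>-\<^sup>1 - P\<close>.
\<close>

lemma pseudoinverse_mult_laplacian: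
  fixes L :: "real ^ 'n ^ 'n"
  assumes sym: "transpose L = L"
    and ker: "\<And>x. L *v x = 0 \<longleftrightarrow> (\<exists>c. x = (\<chi> i. c))"
  shows "pseudoinverse L ** L = mat 1 - mean_matrix"
proof -
  let ?P = "mean_matrix :: real ^ 'n ^ 'n"
  have "L *v (?P *v x) = 0" for x
    unfolding ker by (auto simp: vec_eq_iff mean_matrix_mult_vec)
  then have LP: "L ** ?P = 0"
    by (simp add: matrix_eq flip: matrix_vector_mul_assoc)
  have PL: "?P ** L = 0"
    using arg_cong[OF LP, of transpose]
    by (simp add: matrix_transpose_mul transpose_mean_matrix sym) (simp add: transpose_def vec_eq_iff)
  \<comment> \<open>Applying \<open>?P\<close> kills the \<open>L\<close> part and leaves
    \<open>?P *v x = 0\<close>, so \<open>x\<close> also lies in the kernel of \<open>L\<close>: a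
    constant vector of mean 0.\<close>
  have "x = 0" if x: "(L + ?P) *v x = 0" for x
  proof -
    have "(?P ** (L + ?P)) *v x = 0"
      using x by (simp flip: matrix_vector_mul_assoc)
    then have Px: "?P *v x = 0"
      by (simp add: matrix_add_ldistrib PL mean_matrix_idem)
    then have "L *v x = 0"
      using x by (simp add: matrix_vector_mult_add_rdistrib)
    then obtain c where "x = (\<chi> i. c)"
      using ker by auto
    then show ?thesis
      using Px by (simp add: vec_eq_iff mean_matrix_mult_vec)
  qed
  then obtain K where K: "K ** (L + ?P) = mat 1"
    using matrix_left_invertible_ker[of "L + ?P"] by blast
  then have K': "(L + ?P) ** K = mat 1"
    by (simp add: matrix_left_right_inverse)
  have KP: "K ** ?P = ?P"
  proof -
    have "K ** ?P = K ** ((L + ?P) ** ?P)"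
      by (simp add: matrix_add_rdistrib LP mean_matrix_idem)
    then show ?thesis by (simp add: matrix_mul_assoc K)
  qed
  have PK: "?P ** K = ?P"
  proof -
    have "?P ** K = (?P ** (L + ?P)) ** K"
      by (simp add: matrix_add_ldistrib PL mean_matrix_idem)
    then show ?thesis by (simp add: matrix_mul_assoc[symmetric] K')
  qed
  have KL: "K ** L = mat 1 - ?P"
    using K KP by (simp add: matrix_add_ldistrib eq_diff_eq)
  have LK: "L ** K = mat 1 - ?P"
    using K' PK by (simp add: matrix_add_rdistrib eq_diff_eq)
  let ?X = "K - ?P"
  have XL: "?X ** L = mat 1 - ?P"
    by (simp add: matrix_diff_rdistrib KL PL)
  have LX: "L ** ?X = mat 1 - ?P"
    by (simp add: matrix_diff_ldistrib LK LP)
  have "transpose (mat 1 - ?P) = mat 1 - ?P"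
    by (simp add: transpose_def mean_matrix_def mat_def vec_eq_iff)
  then have "is_pseudoinverse L ?X"
    unfolding is_pseudoinverse_def XL LX
    by (simp add: matrix_diff_rdistrib matrix_diff_ldistrib PL PK mean_matrix_idem)
  then show ?thesis
    using XL by (simp add: pseudoinverse_eqI)
qed

section \<open>Rows of the hat matrix\<close>

lemma endpoints_less: "ref_tail e < ref_head e"
  using endpoints[of e] by (auto simp: ref_tail_def ref_head_def)

lemma incidence_matrix_mult_vec:
  "(incidence_matrix *v g) $ e = g $ ref_tail e - g $ ref_head e"
proof -
  have "(incidence_matrix *v g) $ e
      = (\<Sum>v\<in>UNIV. (if v = ref_tail e then g $ v else 0) - (if v = ref_head e then g $ v else 0))"
    unfolding incidence_matrix_def matrix_vector_mult_def
    using endpoints_less[of e] by (auto intro!: sum.cong)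
  then show ?thesis
    by (simp add: sum_subtractf)
qed

text \<open>Ohm's law: \<open>W $ e $ e\<close> is the conductance of \<open>e\<close>, and
  \<open>x\<close> is the vector of potentials.\<close>

lemma incidence_matrix_transpose_mult_weight:
  assumes "is_weight_matrix E W"
  shows "(x v* (transpose incidence_matrix ** W)) $ e = W $ e $ e * (x $ ref_tail e - x $ ref_head e)"
proof -
  have "x v* (transpose incidence_matrix ** W) = transpose W *v (incidence_matrix *v x)"
    by (simp add: matrix_vector_mul_assoc flip: transpose_matrix_vector)
      (simp add: matrix_transpose_mul)
  moreover have "(transpose W *v y) $ e = (\<Sum>f\<in>UNIV. if f = e then W $ e $ e * y $ e else 0)" for y
  proof -
    have "W $ f $ e * y $ f = (if f = e then W $ e $ e * y $ e else 0)" for f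
      using assms by (simp add: is_weight_matrix_def)
    then show ?thesis
      unfolding matrix_vector_mult_def transpose_def vec_lambda_beta by (intro sum.cong refl)
  qed
  ultimately show ?thesis
    by (simp add: incidence_matrix_mult_vec)
qed

section \<open>The weighted Laplacian and its kernel\<close>

definition laplacian ::
    "real ^ 'v::{card2, linorder} comparison ^ 'v comparison \<Rightarrow> real ^ 'v::{card2, linorder} ^ 'v::{card2, linorder}" where
  "laplacian W = transpose incidence_matrix ** W ** incidence_matrix"

lemma laplacian_quadratic_form:
  assumes "is_weight_matrix E W"
  shows "x \<bullet> (laplacian W *v x) = (\<Sum>e\<in>UNIV. W $ e $ e * (x $ ref_tail e - x $ ref_head e)\<^sup>2)"
proof -
  have "x \<bullet> (laplacian W *v x)
      = (x v* (transpose incidence_matrix ** W)) \<bullet> (incidence_matrix *v x)"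
    by (simp add: laplacian_def dot_lmul_matrix matrix_vector_mul_assoc)
  then show ?thesis
    by (simp add: inner_vec_def incidence_matrix_transpose_mult_weight[OF assms]
        incidence_matrix_mult_vec power2_eq_square mult_ac)
qed

text \<open>A kernel vector has zero energy. The energy is a sum of nonnegative terms, so the vector
  agrees at the two ends of every edge, and connectedness makes it constant.\<close>

lemma laplacian_kernel:
  assumes conn: "Digraph_Component.connected (network_graph E)" and W: "is_weight_matrix E W"
  shows "laplacian W *v x = 0 \<longleftrightarrow> (\<exists>c. x = (\<chi> i. c))"
proof
  assume "laplacian W *v x = 0"
  then have "(\<Sum>e\<in>UNIV. W $ e $ e * (x $ ref_tail e - x $ ref_head e)\<^sup>2) = 0"
    by (simp flip: laplacian_quadratic_form[OF W])
  moreover have "0 \<le> W $ e $ e" for e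
    using W by (cases "e \<in> E") (auto simp: is_weight_matrix_def less_imp_le)
  ultimately have "W $ e $ e * (x $ ref_tail e - x $ ref_head e)\<^sup>2 = 0" for e
    by (subst (asm) sum_nonneg_eq_0_iff) auto
  then have edge: "x $ ref_tail e = x $ ref_head e" if "e \<in> E" for e
    using that W unfolding is_weight_matrix_def by (metis eq_iff_diff_eq_0 less_irrefl mult_eq_0_iff power_eq_0_iff)
  have "x $ u = x $ v" for u v
  proof -
    \<comment> \<open>Connectedness is strong connectedness of the symmetric closure, so the chain
      from \<open>u\<close> to \<open>v\<close> may use edges in either direction.\<close>
    let ?S = "with_proj (mk_symmetric (network_graph E))"
    have "(u, v) \<in> (arcs_ends ?S)\<^sup>*"
      using conn by (intro reachable_rtranclI)
        (simp add: Digraph_Component.connected_def strongly_connected_def network_graph_def)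
    then show ?thesis
    proof (induction rule: rtrancl_induct)
      case (step y z)
      then have "x $ y = x $ z"
        by (auto simp: parcs_mk_symmetric network_graph_def edge)
      with step show ?case by simp
    qed simp
  qed
  then show "\<exists>c. x = (\<chi> i. c)"
    by (auto simp: vec_eq_iff)
next
  assume "\<exists>c. x = (\<chi> i. c)"
  then have "incidence_matrix *v x = 0"
    by (auto simp: vec_eq_iff incidence_matrix_mult_vec)
  then show "laplacian W *v x = 0"
    by (simp add: laplacian_def flip: matrix_vector_mul_assoc)
qed

text \<open>The incidence row of \<open>A:B\<close> is \<open>axis A 1 - axis B 1\<close>. Swapping
  \<open>A\<close> and \<open>B\<close> negates it, which matches the sign in
  \<open>hat_row\<close>, so one formula serves both orders.\<close>

lemma hat_row_eq:
  assumes "A \<noteq> B"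
  shows "hat_row W A B
    = (axis A 1 - axis B 1) v* (pseudoinverse (laplacian W) ** (transpose incidence_matrix ** W))"
proof -
  have row: "row (Comparison (a, b)) (hat_matrix W)
      = (axis a 1 - axis b 1) v* (pseudoinverse (laplacian W) ** (transpose incidence_matrix ** W))"
    if "a < b" for a b
  proof -
    have ends: "ref_tail (Comparison (a, b)) = a" "ref_head (Comparison (a, b)) = b"
      using that by (simp_all add: ref_tail_def ref_head_def Comparison_inverse)
    have "row (Comparison (a, b)) incidence_matrix = (axis a 1 - axis b 1 :: real ^ _)"
      using that by (auto simp: row_def incidence_matrix_def ends vec_eq_iff axis_def)
    moreover have "hat_matrix W
        = incidence_matrix ** (pseudoinverse (laplacian W) ** (transpose incidence_matrix ** W))"
      by (simp add: hat_matrix_def laplacian_def matrix_mul_assoc)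
    ultimately show ?thesis
      by (simp only: row_matrix_mult)
  qed
  show ?thesis
  proof (cases "A < B")
    case True
    then show ?thesis by (simp add: hat_row_def row)
  next
    case False
    with assms have "B < A" by simp
    with False show ?thesis by (simp add: hat_row_def row flip: uminus_vector_matrix_mult)
  qed
qed

lemma hat_row_potential:
  assumes "is_weight_matrix E W" and "A \<noteq> B"
  obtains x where "\<And>e. hat_row W A B $ e = W $ e $ e * (x $ ref_tail e - x $ ref_head e)"
proof (rule that)
  let ?x = "(axis A 1 - axis B 1) v* pseudoinverse (laplacian W)"
  have "hat_row W A B = ?x v* (transpose incidence_matrix ** W)"
    by (simp only: hat_row_eq[OF assms(2)] vector_matrix_mul_assoc)
  then show "hat_row W A B $ e = W $ e $ e * (?x $ ref_tail e - ?x $ ref_head e)" for e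
    by (simp only: incidence_matrix_transpose_mult_weight[OF assms(1)])
qed

text \<open>Kirchhoff's law tested against an arbitrary vertex function: one unit enters at
  \<open>A\<close> and leaves at \<open>B\<close>. The pseudoinverse times the Laplacian only
  subtracts the mean of \<open>g\<close>, which cancels in the difference
  \<open>g A - g B\<close>.\<close>

lemma hat_row_conservation:
  assumes "Digraph_Component.connected (network_graph E)" and "is_weight_matrix E W" and "A \<noteq> B"
  shows "(\<Sum>e\<in>UNIV. hat_row W A B $ e * (g (ref_tail e) - g (ref_head e))) = g A - g B"
proof -
  let ?L = "laplacian W" and ?g = "\<chi> v. g v" and ?d = "axis A 1 - axis B 1"
  have "transpose W = W"
    using assms(2) by (auto simp: is_weight_matrix_def transpose_def vec_eq_iff) metis
  then have "transpose ?L = ?L"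
    by (simp add: laplacian_def matrix_transpose_mul transpose_transpose matrix_mul_assoc)
  note XL = pseudoinverse_mult_laplacian[OF this laplacian_kernel[OF assms(1,2)]]
  have "(\<Sum>e\<in>UNIV. hat_row W A B $ e * (g (ref_tail e) - g (ref_head e)))
      = hat_row W A B \<bullet> (incidence_matrix *v ?g)"
    by (simp add: inner_vec_def incidence_matrix_mult_vec)
  also have "\<dots> = ?d \<bullet> ((pseudoinverse ?L ** ?L) *v ?g)"
    by (simp add: hat_row_eq[OF assms(3)] dot_lmul_matrix matrix_vector_mul_assoc)
      (simp add: laplacian_def matrix_mul_assoc)
  also have "\<dots> = g A - g B"
    by (simp add: XL matrix_vector_mult_diff_rdistrib inner_diff_left inner_axis' mean_matrix_mult_vec)
  finally show ?thesis .
qed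

section \<open>Flows driven by a potential\<close>

text \<open>Conservation is assumed for every test function \<open>g\<close> because each use picks
  its own: indicators of vertices give balance equations, indicators of sets give cuts, and
  \<open>pot\<close> gives the dissipation.\<close>

locale potential_flow = fin_digraph G
  for G :: "('a, 'b) pre_digraph" (structure) +
  fixes flow :: "'b \<Rightarrow> real" and pot :: "'a \<Rightarrow> real" and s t :: 'a
  assumes flow_pos: "e \<in> arcs G \<Longrightarrow> 0 < flow e"
    and pot_decreasing: "e \<in> arcs G \<Longrightarrow> pot (head G e) < pot (tail G e)"
    and conservation:
      "(\<Sum>e\<in>arcs G. flow e * (g (tail G e) - g (head G e))) = g s - g (t :: 'a)"
    and source_neq_sink: "s \<noteq> t"
    and source_in_verts: "s \<in> verts G"
begin

section \<open>Acyclicity and telescoping along walks\<close>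

lemma pot_tail_le:
  assumes "awalk u p v" "e \<in> set p"
  shows "pot (tail G e) \<le> pot u"
  using assms
proof (induction p arbitrary: u)
  case (Cons a p)
  then have "e = a \<or> pot (tail G e) \<le> pot (head G a)" and "pot (head G a) < pot u" "tail G a = u"
    by (auto simp: awalk_Cons_iff intro: pot_decreasing)
  then show ?case by auto
qed auto

lemma pot_awalk_verts_le:
  assumes "awalk u p v" "w \<in> set (awalk_verts u p)"
  shows "pot w \<le> pot u"
  using assms
proof (induction p arbitrary: u)
  case (Cons a p)
  then have "w = u \<or> pot w \<le> pot (head G a)" and "pot (head G a) < pot u"
    by (auto simp: awalk_Cons_iff intro: pot_decreasing)
  then show ?case by auto
qed auto

text \<open>The potential drops strictly along every arc, so a walk never returns to its
  start.\<close>

lemma awalk_imp_apath: "awalk u p v \<Longrightarrow> apath u p v"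
proof (induction p arbitrary: u)
  case (Cons a p)
  then have "awalk (head G a) p v" "pot (head G a) < pot u"
    by (auto simp: awalk_Cons_iff intro: pot_decreasing)
  then have "u \<notin> set (awalk_verts (head G a) p)"
    using pot_awalk_verts_le by fastforce
  with Cons show ?case
    by (auto simp: apath_Cons_iff awalk_Cons_iff)
qed (simp add: awalk_Nil_iff apath_Nil_iff)

lemma directed_paths_iff_awalk: "p \<in> directed_paths G u v \<longleftrightarrow> awalk u p v"
  using awalk_imp_apath by (auto simp: directed_paths_def apath_def)

lemma finite_directed_paths: "finite (directed_paths G u v)"
  unfolding directed_paths_def by (rule apaths_finite)

lemma directed_paths_refl: "u \<in> verts G \<Longrightarrow> directed_paths G u u = {[]}"
  by (auto simp: directed_paths_iff_awalk awalk_Nil_iff)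
    (metis apath_nonempty_ends awalk_imp_apath neq_Nil_conv)

lemma awalk_telescope:
  fixes g :: "'a \<Rightarrow> real"
  assumes "awalk u p v"
  shows "(\<Sum>e\<in>arcs G. of_bool (e \<in> set p) * (g (tail G e) - g (head G e))) = g u - g v"
  using assms
proof (induction p arbitrary: u)
  case (Cons a p)
  then have a: "a \<in> arcs G" "tail G a = u" and p: "awalk (head G a) p v"
    by (auto simp: awalk_Cons_iff)
  \<comment> \<open>Every arc of \<open>p\<close> has a tail of potential at most that of
    \<open>head G a\<close>, which is below that of \<open>tail G a\<close>. Thus no arc repeats,
    and summing over the set of arcs loses no multiplicity.\<close>
  have "a \<notin> set p"
    using pot_tail_le[OF p, of a] pot_decreasing[OF a(1)] by auto
  then have "(\<Sum>e\<in>arcs G. of_bool (e \<in> set (a # p)) * (g (tail G e) - g (head G e)))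
      = (\<Sum>e\<in>arcs G. (if e = a then g (tail G e) - g (head G e) else 0)
           + of_bool (e \<in> set p) * (g (tail G e) - g (head G e)))"
    by (intro sum.cong) auto
  also have "\<dots> = (g (tail G a) - g (head G a)) + (g (head G a) - g v)"
    using Cons.IH[OF p] a by (simp add: sum.distrib)
  finally show ?case using a by simp
qed (simp add: awalk_Nil_iff)

lemma sink_pot_less: "pot t < pot s"
proof -
  have "arcs G \<noteq> {}"
    \<comment> \<open>Tested against the indicator of \<open>s\<close>, conservation has right side
      1, so the sum over arcs is not empty.\<close>
    using conservation[of "\<lambda>v. of_bool (v = s)"] source_neq_sink by auto
  then have "0 < (\<Sum>e\<in>arcs G. flow e * (pot (tail G e) - pot (head G e)))"
    by (intro sum_pos) (auto intro!: mult_pos_pos flow_pos pot_decreasing)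
  then show ?thesis
    by (simp add: conservation)
qed

subsection \<open>Path decompositions\<close>

definition path_load :: "('b awalk \<Rightarrow> real) \<Rightarrow> 'b \<Rightarrow> real" where
  "path_load \<phi> e = (\<Sum>p\<in>directed_paths G s t. \<phi> p * of_bool (e \<in> set p))"

definition decomposes_flow :: "('b awalk \<Rightarrow> real) \<Rightarrow> bool" where
  "decomposes_flow \<phi> \<longleftrightarrow> (\<forall>e\<in>arcs G. path_load \<phi> e = flow e)"

lemma path_load_telescope:
  fixes g :: "'a \<Rightarrow> real"
  shows "(\<Sum>e\<in>arcs G. path_load \<phi> e * (g (tail G e) - g (head G e)))
    = (\<Sum>p\<in>directed_paths G s t. \<phi> p) * (g s - g t)"
proof -
  have "(\<Sum>e\<in>arcs G. path_load \<phi> e * (g (tail G e) - g (head G e)))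
      = (\<Sum>p\<in>directed_paths G s t. \<phi> p *
          (\<Sum>e\<in>arcs G. of_bool (e \<in> set p) * (g (tail G e) - g (head G e))))"
    unfolding path_load_def sum_distrib_right sum_distrib_left
    by (subst sum.swap) (simp add: mult_ac)
  also have "\<dots> = (\<Sum>p\<in>directed_paths G s t. \<phi> p * (g s - g t))"
    by (intro sum.cong refl arg_cong2[where f = "(*)"] awalk_telescope)
      (auto simp: directed_paths_iff_awalk)
  finally show ?thesis
    by (simp add: sum_distrib_right)
qed

lemma decomposition_total_weight:
  assumes "decomposes_flow \<phi>"
  shows "(\<Sum>p\<in>directed_paths G s t. \<phi> p) = 1"
proof -
  have "(\<Sum>p\<in>directed_paths G s t. \<phi> p) * (pot s - pot t) = pot s - pot t"
    using assms conservation[of pot] path_load_telescope[of \<phi> pot]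
    by (simp add: decomposes_flow_def)
  then show ?thesis
    using sink_pot_less by simp
qed

lemma L1_norm_decomposition_ge:
  "decomposes_flow \<phi> \<Longrightarrow> 1 \<le> path_L1_norm G s t \<phi>"
  unfolding path_L1_norm_def decomposition_total_weight[symmetric]
  by (intro sum_mono) auto

lemma L1_norm_nonneg_decomposition:
  "decomposes_flow \<phi> \<Longrightarrow> (\<And>p. p \<in> directed_paths G s t \<Longrightarrow> 0 \<le> \<phi> p) \<Longrightarrow> path_L1_norm G s t \<phi> = 1"
  unfolding path_L1_norm_def by (simp flip: decomposition_total_weight)

subsection \<open>The greedy decomposition\<close>

text \<open>The loop invariant. Its last clause says that a path with nonzero weight has an
  exhausted arc, so the algorithm never selects a path twice and overwriting its weight amounts to
  adding to it.\<close>

definition residual_state :: "('b \<Rightarrow> real) \<times> ('b awalk \<Rightarrow> real) \<Rightarrow> bool" where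
  "residual_state = (\<lambda>(r, \<phi>).
     (\<forall>e\<in>arcs G. 0 \<le> r e \<and> flow e = r e + path_load \<phi> e) \<and>
     (\<forall>p\<in>directed_paths G s t. 0 \<le> \<phi> p \<and> (\<phi> p = 0 \<or> (\<exists>e\<in>set p. r e = 0))))"

lemma residual_state_step:
  assumes "shortestpath_step G s t \<sigma> \<sigma>'" and "residual_state \<sigma>"
  shows "residual_state \<sigma>'"
  using assms
proof cases
  case (1 r p f \<phi>)
  from 1(3) have path: "p \<in> directed_paths G s t" and pos: "\<And>e. e \<in> set p \<Longrightarrow> 0 < r e"
    by (auto simp: is_arg_min_def available_paths_def)
  have "p \<noteq> []"
    using path source_neq_sink by (auto simp: directed_paths_iff_awalk awalk_Nil_iff)
  then have f_le: "\<And>e. e \<in> set p \<Longrightarrow> f \<le> r e" and "f \<in> r ` set p"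
    unfolding 1(4) by (auto intro!: Min_in)
  then obtain a where a: "a \<in> set p" "r a = f"
    by auto
  have "0 < f"
    using pos[OF a(1)] a by simp
  from assms(2) have inv: "\<forall>e\<in>arcs G. 0 \<le> r e \<and> flow e = r e + path_load \<phi> e"
      "\<forall>q\<in>directed_paths G s t. 0 \<le> \<phi> q \<and> (\<phi> q = 0 \<or> (\<exists>e\<in>set q. r e = 0))"
    by (auto simp: residual_state_def 1)
  \<comment> \<open>All arcs of the selected path still have positive residual, so its old weight is
    0 and \<open>\<phi>(p := f)\<close> raises the load by exactly \<open>f\<close> along
    \<open>p\<close>.\<close>
  have "\<phi> p = 0"
    using inv(2) path pos by force
  then have "(\<phi>(p := f)) q * of_bool (e \<in> set q)
      = \<phi> q * of_bool (e \<in> set q) + (if q = p then f * of_bool (e \<in> set p) else 0)" for e q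
    by simp
  then have load: "path_load (\<phi>(p := f)) e = path_load \<phi> e + f * of_bool (e \<in> set p)" for e
    unfolding path_load_def
    using path finite_directed_paths[of s t]
    by (simp only: sum.distrib) simp
  have "(\<phi>(p := f)) q = 0 \<or> (\<exists>e\<in>set q. (if e \<in> set p then r e - f else r e) = 0)"
    if "q \<in> directed_paths G s t" for q
  proof (cases "q = p \<or> \<phi> q = 0")
    case True
    then show ?thesis using a by auto
  next
    case False
    with inv(2) that obtain e where "e \<in> set q" "r e = 0"
      by blast
    moreover from this have "e \<notin> set p"
      using pos by force
    ultimately show ?thesis by auto
  qed
  moreover have "0 \<le> (\<phi>(p := f)) q" if "q \<in> directed_paths G s t" for q
    using inv(2) that \<open>0 < f\<close> by auto
  moreover have "0 \<le> (if e \<in> set p then r e - f else r e) \<and>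
      flow e = (if e \<in> set p then r e - f else r e) + path_load (\<phi>(p := f)) e"
    if "e \<in> arcs G" for e
    using inv(1) that f_le by (auto simp: load)
  ultimately show ?thesis
    unfolding 1(2) residual_state_def by blast
qed

text \<open>
  The residual is a flow of value \<open>k\<close>. The cut around the vertices still reachable from \<open>s\<close> gives
  \<open>k \<le> 0\<close>, while the dissipation of the residual is \<open>k * (pot s - pot t)\<close> and all its terms are
  nonnegative, so all of them are 0.
\<close>

lemma residual_vanishes:
  assumes "residual_state (r, \<phi>)" and "available_paths G s t r = {}" and "e \<in> arcs G"
  shows "r e = 0"
proof -
  have r: "0 \<le> r a" "flow a = r a + path_load \<phi> a" if "a \<in> arcs G" for a
    using assms(1) that by (auto simp: residual_state_def)
  define k where "k = 1 - (\<Sum>p\<in>directed_paths G s t. \<phi> p)"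
  have cons: "(\<Sum>a\<in>arcs G. r a * (g (tail G a) - g (head G a))) = k * (g s - g t)" for g
  proof -
    have "(\<Sum>a\<in>arcs G. r a * (g (tail G a) - g (head G a)))
        = (\<Sum>a\<in>arcs G. flow a * (g (tail G a) - g (head G a))
            - path_load \<phi> a * (g (tail G a) - g (head G a)))"
      by (intro sum.cong) (auto simp: r(2) algebra_simps)
    then show ?thesis
      by (simp only: sum_subtractf conservation path_load_telescope)
        (simp add: k_def algebra_simps)
  qed
  define S where "S = {v. \<exists>p. awalk s p v \<and> (\<forall>a\<in>set p. 0 < r a)}"
  have "s \<in> S"
    using source_in_verts by (auto simp: S_def awalk_Nil_iff intro!: exI[of _ "[]"])
  moreover have "t \<notin> S"
    using assms(2) by (auto simp: S_def available_paths_def directed_paths_iff_awalk)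
  moreover have closed: "head G a \<in> S" if "a \<in> arcs G" "tail G a \<in> S" "0 < r a" for a
  proof -
    from that obtain p where "awalk s p (tail G a)" "\<forall>b\<in>set p. 0 < r b"
      by (auto simp: S_def)
    then have "awalk s (p @ [a]) (head G a) \<and> (\<forall>b\<in>set (p @ [a]). 0 < r b)"
      using that by (auto intro: arc_implies_awalk)
    then show ?thesis
      unfolding S_def by blast
  qed
  ultimately have "k = (\<Sum>a\<in>arcs G. r a * (of_bool (tail G a \<in> S) - of_bool (head G a \<in> S)))"
    using cons[of "\<lambda>v. of_bool (v \<in> S)"] by simp
  \<comment> \<open>An arc leaving \<open>S\<close> has residual 0, since otherwise its head would
    be in \<open>S\<close>; an arc entering \<open>S\<close> contributes minus its residual.\<close>
  also have "\<dots> \<le> 0"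
    using closed r(1) by (intro sum_nonpos) (force simp: less_le)
  finally have "(\<Sum>a\<in>arcs G. r a * (pot (tail G a) - pot (head G a))) \<le> 0"
    using sink_pot_less unfolding cons by (simp add: mult_le_0_iff)
  moreover have "0 \<le> r a * (pot (tail G a) - pot (head G a))" if "a \<in> arcs G" for a
    using that r(1) pot_decreasing by (simp add: less_imp_le)
  ultimately have "\<forall>a\<in>arcs G. r a * (pot (tail G a) - pot (head G a)) = 0"
    by (subst sum_nonneg_eq_0_iff[symmetric]) (auto intro: antisym sum_nonneg)
  then show ?thesis
    using assms(3) pot_decreasing[OF assms(3)] by auto
qed

lemma greedy_decomposition:
  assumes "(shortestpath_step G s t)\<^sup>*\<^sup>* (r\<^sub>0, \<lambda>p. 0) (r, \<phi>)"
    and "available_paths G s t r = {}" and "\<And>e. e \<in> arcs G \<Longrightarrow> r\<^sub>0 e = flow e"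
  shows "decomposes_flow \<phi>" and "p \<in> directed_paths G s t \<Longrightarrow> 0 \<le> \<phi> p"
proof -
  have "residual_state (r\<^sub>0, \<lambda>p. 0)"
    using assms(3) flow_pos by (auto simp: residual_state_def path_load_def less_imp_le)
  with assms(1) have "residual_state (r, \<phi>)"
    by (induction rule: rtranclp_induct) (auto intro: residual_state_step)
  with residual_vanishes[OF this assms(2)]
  show "decomposes_flow \<phi>" "p \<in> directed_paths G s t \<Longrightarrow> 0 \<le> \<phi> p"
    by (auto simp: residual_state_def decomposes_flow_def)
qed

subsection \<open>The random walk decomposition\<close>

definition step_prob :: "'b \<Rightarrow> real" where
  "step_prob e = flow e / (\<Sum>f\<in>out_arcs G (tail G e). flow f)"

definition walk_prob :: "'b awalk \<Rightarrow> real" where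
  "walk_prob p = prod_list (map step_prob p)"

lemma walk_prob_simps [simp]: "walk_prob [] = 1" "walk_prob (a # p) = step_prob a * walk_prob p"
  by (simp_all add: walk_prob_def)

lemma outflow_pos: "out_arcs G v \<noteq> {} \<Longrightarrow> 0 < (\<Sum>f\<in>out_arcs G v. flow f)"
  by (intro sum_pos finite_out_arcs) (auto intro: flow_pos)

lemma sum_step_prob: "out_arcs G v \<noteq> {} \<Longrightarrow> (\<Sum>a\<in>out_arcs G v. step_prob a) = 1"
  using outflow_pos[of v] by (simp add: step_prob_def flip: sum_divide_distrib)

lemma step_prob_nonneg: "e \<in> arcs G \<Longrightarrow> 0 \<le> step_prob e"
  unfolding step_prob_def
  by (intro divide_nonneg_nonneg sum_nonneg) (auto intro: less_imp_le flow_pos)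

lemma walk_prob_nonneg: "set p \<subseteq> arcs G \<Longrightarrow> 0 \<le> walk_prob p"
  by (induction p) (auto intro!: mult_nonneg_nonneg step_prob_nonneg)

text \<open>Consider the vertices of potential below \<open>pot t\<close>. Neither \<open>s\<close>
  nor \<open>t\<close> is among them, so the net flow into this set is 0, and no arc leaves it since
  arcs go downhill. Hence no arc enters it, but an arc out of \<open>t\<close> would.\<close>

lemma out_arcs_sink: "out_arcs G t = {}"
proof (rule ccontr)
  assume "out_arcs G t \<noteq> {}"
  then obtain e where e: "e \<in> arcs G" "tail G e = t"
    by (auto simp: out_arcs_def simp del: in_out_arcs_conv)
  let ?g = "\<lambda>v. of_bool (pot v < pot t) :: real"
  have "(\<Sum>a\<in>arcs G. flow a * (?g (head G a) - ?g (tail G a))) = 0"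
    using conservation[of "\<lambda>v. - ?g v"] sink_pot_less by simp
  moreover have "0 \<le> flow a * (?g (head G a) - ?g (tail G a))" if "a \<in> arcs G" for a
    using flow_pos[OF that] pot_decreasing[OF that] by auto
  ultimately have "flow e * (?g (head G e) - ?g (tail G e)) = 0"
    using e(1) by (subst (asm) sum_nonneg_eq_0_iff) auto
  then show False
    using flow_pos[OF e(1)] pot_decreasing[OF e(1)] e(2) by simp
qed

text \<open>A vertex other than \<open>t\<close> that receives flow must pass it on: without
  outgoing arcs its positive inflow would be 0 or -1 by conservation.\<close>

lemma out_arcs_head_nonempty:
  assumes "e \<in> arcs G" and "head G e \<noteq> t"
  shows "out_arcs G (head G e) \<noteq> {}"
proof
  assume "out_arcs G (head G e) = {}"
  then have "tail G a \<noteq> head G e" if "a \<in> arcs G" for a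
    using that by auto
  then have "(\<Sum>a\<in>arcs G. flow a * of_bool (head G a = head G e)) = - of_bool (s = head G e)"
    using conservation[of "\<lambda>v. - of_bool (v = head G e)"] assms(2) by (simp cong: sum.cong)
  moreover have "0 < (\<Sum>a\<in>arcs G. flow a * of_bool (head G a = head G e))"
    using assms(1) flow_pos by (intro sum_pos2[of _ e]) (auto simp: less_imp_le)
  moreover have "(0 :: real) \<le> of_bool (s = head G e)"
    by simp
  ultimately show False
    by linarith
qed

text \<open>First-step analysis. Prepending an arc to a path gives a walk, which is again a path by
  acyclicity, so the tails \<open>q\<close> range over all paths from the head.\<close>

lemma sum_directed_paths_first_arc:
  fixes F :: "'b awalk \<Rightarrow> real"
  assumes "u \<noteq> t"
  shows "(\<Sum>p\<in>directed_paths G u t. F p)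
    = (\<Sum>a\<in>out_arcs G u. \<Sum>q\<in>directed_paths G (head G a) t. F (a # q))"
proof -
  have "directed_paths G u t = (\<Union>a\<in>out_arcs G u. (#) a ` directed_paths G (head G a) t)"
    (is "?P = ?U")
  proof (rule set_eqI)
    fix p
    show "p \<in> ?P \<longleftrightarrow> p \<in> ?U"
      using assms
      by (cases p) (auto simp: directed_paths_iff_awalk awalk_simps image_iff out_arcs_def
          simp del: in_out_arcs_conv)
  qed
  also have "sum F \<dots> = (\<Sum>a\<in>out_arcs G u. sum F ((#) a ` directed_paths G (head G a) t))"
    by (intro sum.UNION_disjoint finite_out_arcs) (auto simp: finite_directed_paths)
  also have "\<dots> = (\<Sum>a\<in>out_arcs G u. \<Sum>q\<in>directed_paths G (head G a) t. F (a # q))"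
    by (simp add: sum.reindex)
  finally show ?thesis .
qed

text \<open>The walk reaches \<open>t\<close> almost surely: it cannot get stuck earlier, and each
  step reduces the number of vertices of lower potential, which is the induction measure.\<close>

lemma sum_walk_prob:
  assumes "u = t \<or> out_arcs G u \<noteq> {}" and "u \<in> verts G"
  shows "(\<Sum>p\<in>directed_paths G u t. walk_prob p) = 1"
  using assms
proof (induction "card {v \<in> verts G. pot v < pot u}" arbitrary: u rule: less_induct)
  case less
  show ?case
  proof (cases "u = t")
    case True
    then show ?thesis using less.prems by (simp add: directed_paths_refl)
  next
    case False
    have head: "(\<Sum>p\<in>directed_paths G (head G a) t. walk_prob p) = 1" if "a \<in> out_arcs G u" for a
    proof (rule less.hyps)
      have a: "a \<in> arcs G" "tail G a = u"
        using that by auto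
      from pot_decreasing[OF a(1)] a
      have "{v \<in> verts G. pot v < pot (head G a)} \<subset> {v \<in> verts G. pot v < pot u}"
        by force
      then show "card {v \<in> verts G. pot v < pot (head G a)} < card {v \<in> verts G. pot v < pot u}"
        by (intro psubset_card_mono) auto
      show "head G a = t \<or> out_arcs G (head G a) \<noteq> {}"
        using out_arcs_head_nonempty a by auto
    qed (use that in auto)
    have "(\<Sum>p\<in>directed_paths G u t. walk_prob p)
        = (\<Sum>a\<in>out_arcs G u. step_prob a * (\<Sum>q\<in>directed_paths G (head G a) t. walk_prob q))"
      by (simp add: sum_directed_paths_first_arc[OF False] sum_distrib_left)
    also have "\<dots> = 1"
      using False less.prems by (simp add: head sum_step_prob del: in_out_arcs_conv)
    finally show ?thesis .
  qed
qed

text \<open>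
  With \<open>R u\<close> the probability that the walk from \<open>u\<close> uses the arc \<open>e\<close>, the one-step recursion
  says that the outflow-weighted sum of \<open>R (tail a)\<close> exceeds that of \<open>R (head a)\<close> by \<open>flow e\<close>;
  by conservation this difference is \<open>R s - R t = R s\<close>.
\<close>

lemma random_walk_decomposition: "decomposes_flow walk_prob"
  unfolding decomposes_flow_def
proof
  fix e
  assume e: "e \<in> arcs G"
  define R where "R u = (\<Sum>p\<in>directed_paths G u t. walk_prob p * of_bool (e \<in> set p))" for u
  \<comment> \<open>If \<open>a = e\<close>, every continuation \<open>q\<close> counts, and these
    have total probability 1. The two cases never overlap, because \<open>a\<close> does not recur
    in \<open>q\<close>.\<close>
  have first: "(\<Sum>q\<in>directed_paths G (head G a) t. walk_prob (a # q) * of_bool (e \<in> set (a # q)))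
      = step_prob a * (R (head G a) + of_bool (a = e))" if a: "a \<in> arcs G" for a
  proof -
    have "walk_prob (a # q) * of_bool (e \<in> set (a # q))
        = step_prob a * (walk_prob q * of_bool (e \<in> set q) + walk_prob q * of_bool (a = e))"
      if "q \<in> directed_paths G (head G a) t" for q
    proof -
      have "a \<notin> set q"
        using pot_tail_le[of "head G a" q t a] pot_decreasing[OF a] that
        by (auto simp: directed_paths_iff_awalk)
      then show ?thesis by auto
    qed
    then have "(\<Sum>q\<in>directed_paths G (head G a) t. walk_prob (a # q) * of_bool (e \<in> set (a # q)))
      = step_prob a * (R (head G a)
          + (\<Sum>q\<in>directed_paths G (head G a) t. walk_prob q) * of_bool (a = e))"
      by (simp add: R_def sum.distrib sum_distrib_left sum_distrib_right distrib_left
          del: set_simps walk_prob_simps)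
    also have "(\<Sum>q\<in>directed_paths G (head G a) t. walk_prob q) = 1"
      using out_arcs_head_nonempty[OF a] a by (intro sum_walk_prob) auto
    finally show ?thesis by simp
  qed
  have node: "(\<Sum>a\<in>out_arcs G v. flow a * R v)
      = (\<Sum>a\<in>out_arcs G v. flow a * (R (head G a) + of_bool (a = e)))" for v
  proof (cases "out_arcs G v = {}")
    case False
    then have "v \<noteq> t"
      using out_arcs_sink by auto
    define c where "c = (\<Sum>f\<in>out_arcs G v. flow f)"
    have "c > 0"
      using outflow_pos[OF False] by (simp add: c_def)
    have "R v = (\<Sum>a\<in>out_arcs G v. step_prob a * (R (head G a) + of_bool (a = e)))"
      unfolding R_def[of v] sum_directed_paths_first_arc[OF \<open>v \<noteq> t\<close>]
      by (intro sum.cong refl first) auto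
    also have "\<dots> = (\<Sum>a\<in>out_arcs G v. flow a * (R (head G a) + of_bool (a = e))) / c"
      unfolding sum_divide_distrib by (intro sum.cong) (auto simp: step_prob_def c_def)
    finally have "c * R v = (\<Sum>a\<in>out_arcs G v. flow a * (R (head G a) + of_bool (a = e)))"
      using \<open>c > 0\<close> by simp
    then show ?thesis
      by (simp add: c_def sum_distrib_right)
  qed simp
  \<comment> \<open>Grouping arcs by their tail turns the recursion at each vertex into an identity
    over all arcs.\<close>
  have by_tail: "(\<Sum>a\<in>arcs G. F a) = (\<Sum>v\<in>verts G. \<Sum>a\<in>out_arcs G v. F a)" for F :: "'b \<Rightarrow> real"
    by (subst sum.group[of "arcs G" "verts G" "tail G" F, symmetric])
      (auto simp: out_arcs_def)
  have "(\<Sum>a\<in>arcs G. flow a * R (tail G a)) = (\<Sum>v\<in>verts G. \<Sum>a\<in>out_arcs G v. flow a * R v)"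
    unfolding by_tail by (intro sum.cong) auto
  also have "\<dots> = (\<Sum>a\<in>arcs G. flow a * (R (head G a) + of_bool (a = e)))"
    by (simp only: node by_tail)
  also have "\<dots> = (\<Sum>a\<in>arcs G. flow a * R (head G a)) + flow e"
    using e by (simp add: distrib_left sum.distrib)
  finally have "R s - R t = flow e"
    using conservation[of R] by (simp add: right_diff_distrib sum_subtractf)
  moreover have "R t = 0"
  proof (cases "t \<in> verts G")
    case True
    then show ?thesis by (simp add: R_def directed_paths_refl)
  next
    case False
    then have "directed_paths G t t = {}"
      by (auto simp: directed_paths_iff_awalk)
    then show ?thesis by (simp add: R_def)
  qed
  ultimately show "path_load walk_prob e = flow e"
    by (simp add: R_def path_load_def)
qed

end

section \<open>Optimality of both weightings\<close>

lemma potential_flow_hat_row: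
  assumes "Digraph_Component.connected (network_graph E)" and W: "is_weight_matrix E W"
    and "A \<noteq> B" and h: "h = hat_row W A B"
  obtains pot where "potential_flow (directed_network E h) (\<lambda>e. \<bar>h $ e\<bar>) pot A B"
proof -
  obtain x where x: "\<And>e. h $ e = W $ e $ e * (x $ ref_tail e - x $ ref_head e)"
    using hat_row_potential[OF W \<open>A \<noteq> B\<close>] unfolding h by blast
  have support: "e \<in> E" if "h $ e \<noteq> 0" for e
    using that W by (auto simp: x is_weight_matrix_def)
  let ?N = "directed_network E h"
  have conservation:
    "(\<Sum>e\<in>arcs ?N. \<bar>h $ e\<bar> * (g (tail ?N e) - g (head ?N e))) = g A - g B" for g
  proof -
    have "(\<Sum>e\<in>arcs ?N. \<bar>h $ e\<bar> * (g (tail ?N e) - g (head ?N e)))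
        = (\<Sum>e\<in>UNIV. h $ e * (g (ref_tail e) - g (ref_head e)))"
      \<comment> \<open>Reversing an edge negates both its entry in \<open>h\<close> and the drop of
        \<open>g\<close>, so each product is unchanged; the omitted edges contribute 0.\<close>
      using support
      by (intro sum.mono_neutral_cong_left) (auto simp: directed_network_def algebra_simps)
    then show ?thesis
      using hat_row_conservation[OF assms(1-3)] by (simp add: h)
  qed
  have "potential_flow ?N (\<lambda>e. \<bar>h $ e\<bar>) (($) x) A B"
  proof
    show "x $ head ?N e < x $ tail ?N e" if "e \<in> arcs ?N" for e
    proof -
      \<comment> \<open>With a positive weight, \<open>h $ e\<close> has the sign of the drop of
        \<open>x\<close>, so directing edges by the sign of \<open>h\<close> directs them
        downhill.\<close>
      have "0 < W $ e $ e"
        using that W by (auto simp: directed_network_def is_weight_matrix_def)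
      then show ?thesis
        using that by (auto simp: directed_network_def x zero_less_mult_iff)
    qed
  qed (use conservation \<open>A \<noteq> B\<close> in \<open>auto simp: directed_network_def\<close>)
  then show ?thesis
    by (rule that)
qed

lemma path_design_matrix_directed_network:
  assumes "p \<in> directed_paths (directed_network E h) A B"
  shows "path_design_matrix (directed_network E h) p e = sgn (h $ e) * of_bool (e \<in> set p)"
proof (cases "e \<in> set p")
  case True
  have "set p \<subseteq> arcs (directed_network E h)"
    using assms by (simp only: directed_paths_def mem_Collect_eq pre_digraph.apath_def
        pre_digraph.awalk_def)
  with True have "h $ e \<noteq> 0"
    unfolding directed_network_def by auto
  moreover have "ref_tail e \<noteq> ref_head e"
    using endpoints_less[of e] by simp
  ultimately show ?thesis
    using True by (simp add: path_design_matrix_def directed_network_def sgn_if)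
qed (simp add: path_design_matrix_def)

text \<open>At an edge, all paths through it run in the direction given by the sign of its entry in
  \<open>h\<close>. Cancelling this sign leaves an equation between path load and absolute flow;
  where the entry is 0, both sides vanish.\<close>

lemma solves_path_system_iff:
  assumes "N = directed_network E h" and support: "{e. h $ e \<noteq> 0} \<subseteq> E"
  shows "solves_path_system N h A B \<phi> \<longleftrightarrow>
    (\<forall>e\<in>arcs N. (\<Sum>p\<in>directed_paths N A B. \<phi> p * of_bool (e \<in> set p)) = \<bar>h $ e\<bar>)"
proof -
  define load where "load e = (\<Sum>p\<in>directed_paths N A B. \<phi> p * of_bool (e \<in> set p))" for e
  have "(\<Sum>p\<in>directed_paths N A B. \<phi> p * path_design_matrix N p e) = sgn (h $ e) * load e" for e
    unfolding load_def sum_distrib_left assms(1)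
    by (intro sum.cong refl) (subst path_design_matrix_directed_network, auto)
  moreover have "h $ e = sgn (h $ e) * load e \<longleftrightarrow> (e \<in> arcs N \<longrightarrow> load e = \<bar>h $ e\<bar>)" for e
  proof -
    have "e \<in> arcs N \<longleftrightarrow> h $ e \<noteq> 0"
      using support by (auto simp: assms(1) directed_network_def)
    then show ?thesis
      by (auto simp: sgn_if)
  qed
  ultimately show ?thesis
    by (auto simp: solves_path_system_def vec_eq_iff load_def)
qed

theorem mainTheorem1:
  fixes E :: "'v::{card2, linorder} comparison set"
    and W :: "real ^ 'v comparison ^ 'v comparison"
    and A B :: 'v
    and h :: "real ^ 'v comparison"
    and N :: "('v, 'v comparison) pre_digraph"
    and \<phi>sp \<phi>rw :: "'v comparison awalk \<Rightarrow> real"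
  assumes "Digraph_Component.connected (network_graph E)"
    and "is_weight_matrix E W"
    and "A \<noteq> B"
    and "h = hat_row W A B"
    and "N = directed_network E h"
    and "shortestpath_weights N h A B \<phi>sp"
    and "\<phi>rw = randomwalk_weights N h"
  shows "solves_path_system N h A B \<phi>sp \<and> solves_path_system N h A B \<phi>rw \<and>
    (\<forall>\<phi>. solves_path_system N h A B \<phi> \<longrightarrow>
       path_L1_norm N A B \<phi>sp \<le> path_L1_norm N A B \<phi> \<and>
       path_L1_norm N A B \<phi>rw \<le> path_L1_norm N A B \<phi>) \<and>
    path_L1_norm N A B \<phi>sp = 1 \<and> path_L1_norm N A B \<phi>rw = 1"
proof -
  obtain pot where "potential_flow N (\<lambda>e. \<bar>h $ e\<bar>) pot A B"
    using potential_flow_hat_row[OF assms(1-4)] unfolding assms(5) by blast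
  then interpret potential_flow N "\<lambda>e. \<bar>h $ e\<bar>" pot A B .
  obtain x where "\<And>e. h $ e = W $ e $ e * (x $ ref_tail e - x $ ref_head e)"
    using hat_row_potential[OF assms(2,3)] unfolding assms(4) by blast
  then have "{e. h $ e \<noteq> 0} \<subseteq> E"
    using assms(2) by (auto simp: is_weight_matrix_def)
  then have solves_iff: "solves_path_system N h A B \<phi> \<longleftrightarrow> decomposes_flow \<phi>" for \<phi>
    by (simp add: solves_path_system_iff[OF assms(5)] decomposes_flow_def path_load_def)
  obtain r where "(shortestpath_step N A B)\<^sup>*\<^sup>* (\<lambda>e. \<bar>h $ e\<bar>, \<lambda>p. 0) (r, \<phi>sp)"
    and "available_paths N A B r = {}"
    using assms(6) by (auto simp: shortestpath_weights_def)
  note sp = greedy_decomposition[OF this refl]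
  have "\<phi>rw = walk_prob"
    by (simp add: assms(7) fun_eq_iff randomwalk_weights_def walk_prob_def
        transition_probability_def step_prob_def cong: map_cong)
  then have rw: "decomposes_flow \<phi>rw" and "\<And>p. p \<in> directed_paths N A B \<Longrightarrow> 0 \<le> \<phi>rw p"
    by (auto simp: random_walk_decomposition directed_paths_iff_awalk awalk_def intro: walk_prob_nonneg)
  then have "path_L1_norm N A B \<phi>sp = 1" "path_L1_norm N A B \<phi>rw = 1"
    using sp by (simp_all add: L1_norm_nonneg_decomposition)
  with sp(1) rw show ?thesis
    by (auto simp: solves_iff intro: L1_norm_decomposition_ge)
qed

end
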